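(* Let $m\ge 1$ and $0\le s\le m$ be integers and let $0<\alpha<1$. Let $T_1,\dots,T_m \ge 0$ be random variables such that $T_{s+1},\dots,T_m$ are independent and, for each $1\le j\le m-s$, $T_{s+j}$ is exponentially distributed with mean $1/j$; the statistics $T_1,\dots,T_s\ge 0$ are arbitrary. For $1\le i\le m$ define $$q_i^* = \exp\left[-\sum_{j=i}^m T_j\right],$$ and let $$\hat{k}_T = \max\left\{k \in\{1,\dots,m\}: q_k^* \le \frac{\alpha k}{m}\right\},$$ with the convention $\max(\emptyset)=0$. Then $$\mathbb{E}\left[\frac{(\hat{k}_T - s)_+}{\max\{\hat{k}_T,\,1\}}\right] = \alpha\,\frac{m-s}{m}.$$ In particular, the rule $\hat{k}_T$ controls the false discovery rate at level $\alpha$.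
   Context: There are ordered hypotheses $H_1,\dots,H_m$ with test statistics $T_1,\dots,T_m$; the first $s$ correspond to signals (non-null) and the remaining $m-s$ are null. The procedure rejecting $H_1,\dots,H_{\hat k_T}$ is called TailStop. The notation $x_+ = \max\{x,0\}$ is used. The false discovery rate of $\hat k_T$ is $\mathbb{E}[(\hat{k}_T - s)_+/\max\{\hat{k}_T,1\}]$, and controlling it at level $\alpha$ means it is at most $\alpha$. *)

theory Defs
  imports "HOL-Probability.Probability"
begin

text \<open>
  Statistics are indexed from 1: \<open>t i\<close> is the statistic of the \<open>i\<close>-th ordered hypothesis, and
  only the values at \<open>i \<in> {1..m}\<close> matter.
\<close>

definition qstar :: "nat \<Rightarrow> (nat \<Rightarrow> real) \<Rightarrow> nat \<Rightarrow> real" where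
  "qstar m t i = exp (- (\<Sum>j=i..m. t j))"

definition tailstop :: "nat \<Rightarrow> real \<Rightarrow> (nat \<Rightarrow> real) \<Rightarrow> nat" where
  "tailstop m \<alpha> t =
     (let K = {k \<in> {1..m}. qstar m t k \<le> \<alpha> * real k / real m}
      in if K = {} then 0 else Max K)"

text \<open>
  The first \<open>s\<close> hypotheses are the non-nulls, so rejecting the first \<open>k\<close> hypotheses makes
  \<open>(k - s)\<^sub>+\<close> false rejections. The subtraction is on the reals.
\<close>

definition fdp :: "nat \<Rightarrow> nat \<Rightarrow> real" where
  "fdp s k = max (real k - real s) 0 / max (real k) 1"

definition FDR :: "'a measure \<Rightarrow> nat \<Rightarrow> ('a \<Rightarrow> nat) \<Rightarrow> real" where
  "FDR M s k = prob_space.expectation M (\<lambda>\<omega>. fdp s (k \<omega>))"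

definition controls_FDR :: "'a measure \<Rightarrow> nat \<Rightarrow> ('a \<Rightarrow> nat) \<Rightarrow> real \<Rightarrow> bool" where
  "controls_FDR M s k \<alpha> \<longleftrightarrow> FDR M s k \<le> \<alpha>"

end

theory Submission
  imports Defs "HOL-Real_Asymp.Real_Asymp"
begin

text \<open>
  Scan the hypotheses from \<open>m\<close> downwards and let \<open>Y k\<close> be \<open>1 / q\<^sub>k\<^sub>+\<^sub>1\<close> (with \<open>q\<^sub>m\<^sub>+\<^sub>1 = 1\<close>) while no
  index above \<open>k\<close> has crossed its threshold, and \<open>0\<close> afterwards. For \<open>k > s\<close> the statistic \<open>T k\<close> is
  exponential with rate \<open>k - s\<close> and independent of \<open>Y k\<close>, and a one-dimensional integral shows that
  \<open>(\<alpha> (k - s) / m) E (Y k)\<close> drops by exactly \<open>((k - s) / k) P(k\<^sub>T = k)\<close> when \<open>k\<close> is decreased by one.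
  Summing over \<open>k\<close> telescopes to the value at \<open>k = m\<close>, because the coefficient vanishes at \<open>k = s\<close>.
\<close>

definition survival :: "nat \<Rightarrow> real \<Rightarrow> (nat \<Rightarrow> real) \<Rightarrow> nat \<Rightarrow> real" where
  "survival m \<alpha> t k =
     (if \<forall>i\<in>{k+1..m}. \<alpha> * real i / real m < qstar m t i then exp (\<Sum>i=k+1..m. t i) else 0)"

text \<open>The state \<open>y\<close> lives on the scale of reciprocals of \<open>qstar\<close>,
  where one more statistic \<open>x\<close> multiplies it by \<open>exp x\<close>. The value 0
  encodes a scan that has already stopped, so the guard \<open>0 < y\<close> prevents a second
  crossing. A tie counts as a crossing, matching the non-strict inequality in
  \<open>tailstop\<close>.\<close>

definition crossing :: "real \<Rightarrow> real \<Rightarrow> real \<Rightarrow> real" where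
  "crossing b x y = (if 0 < y \<and> b \<le> y * exp x then 1 else 0)"

definition advance :: "real \<Rightarrow> real \<Rightarrow> real \<Rightarrow> real" where
  "advance b x y = (if y * exp x < b then y * exp x else 0)"

lemma crossing_nonneg: "0 \<le> crossing b x y"
  and crossing_le: "crossing b x y \<le> 1"
  and advance_nonneg: "0 \<le> y \<Longrightarrow> 0 \<le> advance b x y"
  and advance_le: "0 \<le> b \<Longrightarrow> advance b x y \<le> b"
  by (auto simp: crossing_def advance_def)

lemma measurable_crossing [measurable]: "(\<lambda>z. crossing b (fst z) (snd z)) \<in> borel_measurable (borel \<Otimes>\<^sub>M borel)"
  and measurable_advance [measurable]: "(\<lambda>z. advance b (fst z) (snd z)) \<in> borel_measurable (borel \<Otimes>\<^sub>M borel)"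
  unfolding crossing_def advance_def by measurable

section \<open>The one-step identity for an exponential increment\<close>

lemma nn_integral_exponential_step:
  fixes j b y :: real
  assumes "1 \<le> j" "0 \<le> y" "y \<le> b"
  shows "(\<integral>\<^sup>+x. ennreal ((j - 1) * advance b x y + j * b * crossing b x y)
            \<partial>density lborel (exponential_density j)) = ennreal (j * y)"
proof (cases "y = 0")
  case True
  with assms have "(j - 1) * advance b x y + j * b * crossing b x y = 0" for x
    by (simp add: advance_def crossing_def)
  with True show ?thesis by simp
next
  case False
  with assms have y: "0 < y" and b: "0 < b" by auto
  \<comment> \<open>This is the increment at which \<open>y * exp x\<close> reaches
    \<open>b\<close>. The \<open>advance\<close> part integrates to
    \<open>j * y * (1 - exp (- (j - 1) * \<tau>))\<close> and the \<open>crossing\<close> part to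
    \<open>j * b * exp (- j * \<tau>)\<close>. As \<open>b * exp (- \<tau>) = y\<close>, the
    exponential terms cancel and \<open>j * y\<close> remains.\<close>
  define \<tau> where "\<tau> = ln (b / y)"
  have \<tau>: "0 \<le> \<tau>" "exp \<tau> = b / y"
    using y b assms by (auto simp: \<tau>_def)
  have cross: "y * exp x < b \<longleftrightarrow> x < \<tau>" for x
  proof -
    have "y * exp x < b \<longleftrightarrow> exp x < exp \<tau>"
      unfolding \<tau> using y by (simp add: field_simps)
    then show ?thesis by simp
  qed
  let ?f = "\<lambda>x. (j - 1) * j * y * exp (- (j - 1) * x)"
  let ?g = "\<lambda>x. j * b * j * exp (- j * x)"
  \<comment> \<open>Both closed intervals contain \<tau>, so the split is claimed only off this
    point, which is Lebesgue-null.\<close>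
  have density: "ennreal (exponential_density j x) *
        ennreal ((j - 1) * advance b x y + j * b * crossing b x y)
      = ennreal (?f x) * indicator {0..\<tau>} x + ennreal (?g x) * indicator {\<tau>..} x"
    if "x \<noteq> \<tau>" for x
  proof -
    consider "x < 0" | "0 \<le> x" "x < \<tau>" | "\<tau> < x" using \<open>x \<noteq> \<tau>\<close> by linarith
    moreover have pos: "0 \<le> exponential_density j x"
      using assms by (simp add: exponential_density_def)
    ultimately show ?thesis
    proof cases
      case 1
      then show ?thesis using \<tau> by (simp add: exponential_density_def)
    next
      case 2
      have "exponential_density j x * ((j - 1) * advance b x y + j * b * crossing b x y)
          = (j - 1) * j * y * (exp x * exp (- x * j))"
        using 2 cross[of x] by (simp add: exponential_density_def advance_def crossing_def)
      also have "\<dots> = ?f x"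
        by (simp add: exp_add[symmetric] algebra_simps)
      finally show ?thesis
        using 2 pos by (simp add: ennreal_mult'[symmetric])
    next
      case 3
      have "exponential_density j x * ((j - 1) * advance b x y + j * b * crossing b x y) = ?g x"
        using 3 cross[of x] \<tau>(1) y
        by (auto simp: exponential_density_def advance_def crossing_def mult.commute)
      then show ?thesis
        using 3 pos \<tau>(1) by (simp add: ennreal_mult'[symmetric])
    qed
  qed
  have "(\<integral>\<^sup>+x. ennreal ((j - 1) * advance b x y + j * b * crossing b x y)
            \<partial>density lborel (exponential_density j))
      = (\<integral>\<^sup>+x. ennreal (exponential_density j x) *
              ennreal ((j - 1) * advance b x y + j * b * crossing b x y) \<partial>lborel)"
    by (subst nn_integral_density) (auto simp: advance_def crossing_def)
  also have "\<dots> = (\<integral>\<^sup>+x. ennreal (?f x) * indicator {0..\<tau>} x + ennreal (?g x) * indicator {\<tau>..} x \<partial>lborel)"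
    using AE_lborel_singleton[of \<tau>] by (intro nn_integral_cong_AE) (auto elim!: eventually_mono simp: density)
  also have "\<dots> = (\<integral>\<^sup>+x. ennreal (?f x) * indicator {0..\<tau>} x \<partial>lborel)
                 + (\<integral>\<^sup>+x. ennreal (?g x) * indicator {\<tau>..} x \<partial>lborel)"
    by (rule nn_integral_add) auto
  \<comment> \<open>The factor \<open>j - 1\<close> in the integrand is absorbed by the
    antiderivative \<open>- j * y * exp (- (j - 1) * x)\<close>, so no division by
    \<open>j - 1\<close> occurs and \<open>j = 1\<close> needs no separate case.\<close>
  also have "(\<integral>\<^sup>+x. ennreal (?f x) * indicator {0..\<tau>} x \<partial>lborel)
      = ennreal ((- j * y * exp (- (j - 1) * \<tau>)) - (- j * y * exp (- (j - 1) * 0)))"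
    using assms y \<tau>(1)
    by (intro nn_integral_FTC_Icc) (auto intro!: derivative_eq_intros simp: algebra_simps)
  also have "(\<integral>\<^sup>+x. ennreal (?g x) * indicator {\<tau>..} x \<partial>lborel)
      = ennreal (0 - (- j * b * exp (- j * \<tau>)))"
  proof (rule nn_integral_FTC_atLeast)
    have "((\<lambda>x. exp (- j * x)) \<longlongrightarrow> 0) at_top"
      using assms by real_asymp
    then show "((\<lambda>x. - j * b * exp (- j * x)) \<longlongrightarrow> 0) at_top"
      by (rule tendsto_mult_right_zero)
  qed (use assms b in \<open>auto intro!: derivative_eq_intros\<close>)
  also have "exp (- j * \<tau>) = exp (- (j - 1) * \<tau>) * (y / b)"
  proof -
    have "exp (- j * \<tau>) = exp (- (j - 1) * \<tau>) * exp (- \<tau>)"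
      by (simp add: exp_add[symmetric] algebra_simps)
    then show ?thesis using \<tau>(2) by (simp add: exp_minus)
  qed
  also have "ennreal ((- j * y * exp (- (j - 1) * \<tau>)) - (- j * y * exp (- (j - 1) * 0)))
      + ennreal (0 - (- j * b * (exp (- (j - 1) * \<tau>) * (y / b)))) = ennreal (j * y)"
  proof -
    \<comment> \<open>The exponential is thus at most 1, which makes the first summand nonnegative
      and lets the two \<open>ennreal\<close> values be added as reals.\<close>
    have "(1 - j) * \<tau> \<le> 0" using assms(1) \<tau>(1) by (simp add: mult_nonpos_nonneg)
    with assms y b show ?thesis
      by (subst ennreal_plus[symmetric]) (auto simp: mult_left_le)
  qed
  finally show ?thesis .
qed

text \<open>By independence the joint law is a product, so Tonelli allows integrating over
  \<open>X\<close> first with \<open>Y\<close> frozen, where the one-dimensional identity applies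
  pointwise. The bound \<open>b\<close> on \<open>Y\<close> provides its hypothesis
  \<open>y \<le> b\<close>.\<close>

lemma (in prob_space) expectation_exponential_step:
  fixes X Y :: "'a \<Rightarrow> real" and j b :: real
  assumes indep: "indep_var borel X borel Y"
    and X: "distributed M lborel X (exponential_density j)"
    and "1 \<le> j" and Y: "\<And>\<omega>. 0 \<le> Y \<omega>" "\<And>\<omega>. Y \<omega> \<le> b"
  shows "(j - 1) * expectation (\<lambda>\<omega>. advance b (X \<omega>) (Y \<omega>)) +
         j * b * expectation (\<lambda>\<omega>. crossing b (X \<omega>) (Y \<omega>)) = j * expectation Y"
proof -
  have [measurable]: "X \<in> borel_measurable M" "Y \<in> borel_measurable M"
    using indep by (auto dest: indep_var_rv1 indep_var_rv2)
  have b: "0 \<le> b" using Y order_trans by blast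
  have meas: "(\<lambda>\<omega>. advance b (X \<omega>) (Y \<omega>)) \<in> borel_measurable M"
      "(\<lambda>\<omega>. crossing b (X \<omega>) (Y \<omega>)) \<in> borel_measurable M"
    unfolding advance_def crossing_def by measurable
  have int: "integrable M (\<lambda>\<omega>. advance b (X \<omega>) (Y \<omega>))"
      "integrable M (\<lambda>\<omega>. crossing b (X \<omega>) (Y \<omega>))"
    using meas b Y(1)
    by (auto intro: integrable_const_bound[where B=b] integrable_const_bound[where B=1]
        simp: advance_nonneg advance_le crossing_nonneg crossing_le)
  let ?h = "\<lambda>x y. (j - 1) * advance b x y + j * b * crossing b x y"
  interpret DX: prob_space "distr M borel X" by (rule prob_space_distr) simp
  interpret DY: prob_space "distr M borel Y" by (rule prob_space_distr) simp
  interpret D: pair_prob_space "distr M borel X" "distr M borel Y" ..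
  have DX: "distr M borel X = density lborel (exponential_density j)"
    using distributed_distr_eq_density[OF X] by (simp cong: distr_cong)
  have "(\<integral>\<^sup>+\<omega>. ennreal (?h (X \<omega>) (Y \<omega>)) \<partial>M)
      = (\<integral>\<^sup>+z. ennreal (?h (fst z) (snd z)) \<partial>distr M (borel \<Otimes>\<^sub>M borel) (\<lambda>\<omega>. (X \<omega>, Y \<omega>)))"
    by (subst nn_integral_distr) auto
  also have "\<dots> = (\<integral>\<^sup>+z. ennreal (?h (fst z) (snd z)) \<partial>(distr M borel X \<Otimes>\<^sub>M distr M borel Y))"
    using indep by (simp add: indep_var_distribution_eq)
  also have "\<dots> = (\<integral>\<^sup>+y. (\<integral>\<^sup>+x. ennreal (?h x y) \<partial>distr M borel X) \<partial>distr M borel Y)"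
    by (subst D.nn_integral_snd[symmetric]) auto
  also have "\<dots> = (\<integral>\<^sup>+\<omega>. (\<integral>\<^sup>+x. ennreal (?h x (Y \<omega>)) \<partial>distr M borel X) \<partial>M)"
  proof -
    have "(\<lambda>z. ennreal (?h (snd z) (fst z))) \<in> borel_measurable (borel \<Otimes>\<^sub>M distr M borel X)"
      unfolding advance_def crossing_def by measurable
    from DX.borel_measurable_nn_integral_fst[OF this]
    have "(\<lambda>y. \<integral>\<^sup>+x. ennreal (?h x y) \<partial>distr M borel X) \<in> borel_measurable borel"
      by simp
    then show ?thesis by (subst nn_integral_distr) simp_all
  qed
  also have "\<dots> = (\<integral>\<^sup>+\<omega>. ennreal (j * Y \<omega>) \<partial>M)"
    unfolding DX using nn_integral_exponential_step[OF \<open>1 \<le> j\<close> Y] by simp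
  finally have "(\<integral>\<^sup>+\<omega>. ennreal (?h (X \<omega>) (Y \<omega>)) \<partial>M) = (\<integral>\<^sup>+\<omega>. ennreal (j * Y \<omega>) \<partial>M)" .
  then have "expectation (\<lambda>\<omega>. ?h (X \<omega>) (Y \<omega>)) = expectation (\<lambda>\<omega>. j * Y \<omega>)"
    using \<open>1 \<le> j\<close> Y(1) b meas
    by (subst (1 2) integral_eq_nn_integral)
       (auto intro!: add_nonneg_nonneg mult_nonneg_nonneg advance_nonneg crossing_nonneg)
  then show ?thesis using int by simp
qed

section \<open>Pathwise recursion for the downward scan\<close>

lemma survival_nonneg: "0 \<le> survival m \<alpha> t k"
  by (simp add: survival_def)

lemma survival_top: "survival m \<alpha> t m = 1"
  by (simp add: survival_def)

lemma threshold_less_qstar_iff: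
  assumes "0 < \<alpha>" "1 \<le> k" "k \<le> m"
  shows "\<alpha> * real k / real m < qstar m t k \<longleftrightarrow> exp (\<Sum>i=k..m. t i) < real m / (\<alpha> * real k)"
proof -
  have "0 < exp (\<Sum>i=k..m. t i)" by simp
  with assms show ?thesis
    unfolding qstar_def exp_minus by (auto simp: field_simps)
qed

text \<open>A nonzero value has not crossed at \<open>k + 1\<close>, so it lies below the threshold
  there, and thresholds grow as the index decreases. At \<open>k = m\<close> the value is 1 and
  \<open>\<alpha> < 1\<close> suffices. This bound is what the one-step identity requires of its
  starting state.\<close>

lemma survival_le:
  assumes "0 < \<alpha>" "\<alpha> < 1" "1 \<le> k" "k \<le> m"
  shows "survival m \<alpha> t k \<le> real m / (\<alpha> * real k)"
proof (cases "k = m")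
  case True
  then show ?thesis using assms by (simp add: survival_top field_simps)
next
  case False
  have "exp (\<Sum>i=k+1..m. t i) \<le> real m / (\<alpha> * real k)"
    if "\<forall>i\<in>{k+1..m}. \<alpha> * real i / real m < qstar m t i"
  proof -
    have "\<alpha> * real (k+1) / real m < qstar m t (k+1)"
      by (rule that[rule_format]) (use False assms in auto)
    then have "exp (\<Sum>i=k+1..m. t i) < real m / (\<alpha> * real (k+1))"
      using threshold_less_qstar_iff[of \<alpha> "k+1" m t] assms False by auto
    also have "\<dots> \<le> real m / (\<alpha> * real k)"
      using assms by (intro divide_left_mono) auto
    finally show ?thesis by simp
  qed
  then show ?thesis using assms by (simp add: survival_def)
qed

lemma exp_sum_split_first:
  fixes t :: "nat \<Rightarrow> real"
  assumes "k \<le> m"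
  shows "exp (\<Sum>i=k..m. t i) = exp (\<Sum>i=k+1..m. t i) * exp (t k)"
  using assms by (simp add: sum.atLeast_Suc_atMost exp_add mult.commute)

lemma survival_step:
  assumes "0 < \<alpha>" "1 \<le> k" "k \<le> m"
  shows "survival m \<alpha> t (k - 1) = advance (real m / (\<alpha> * real k)) (t k) (survival m \<alpha> t k)"
proof -
  have I: "{k..m} = insert k {k+1..m}" using assms by auto
  have "(\<forall>i\<in>{k..m}. \<alpha> * real i / real m < qstar m t i) \<longleftrightarrow>
      exp (\<Sum>i=k..m. t i) < real m / (\<alpha> * real k) \<and>
      (\<forall>i\<in>{k+1..m}. \<alpha> * real i / real m < qstar m t i)"
    unfolding I ball_simps using threshold_less_qstar_iff[OF assms, of t] I by simp
  moreover have "k - 1 + 1 = k" using assms by simp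
  ultimately show ?thesis
    using exp_sum_split_first[OF \<open>k \<le> m\<close>, of t] by (auto simp: survival_def advance_def)
qed

text \<open>The maximum is the first index to pass when scanning downwards: \<open>k\<close> passes
  and nothing above it does. The latter is exactly positivity of \<open>survival\<close> at
  \<open>k\<close>.\<close>

lemma crossing_survival:
  assumes "0 < \<alpha>" "1 \<le> k" "k \<le> m"
  shows "crossing (real m / (\<alpha> * real k)) (t k) (survival m \<alpha> t k) =
    (if tailstop m \<alpha> t = k then 1 else 0)"
proof -
  define K where "K = {k \<in> {1..m}. qstar m t k \<le> \<alpha> * real k / real m}"
  have [simp]: "finite K" by (simp add: K_def)
  have "tailstop m \<alpha> t = (if K = {} then 0 else Max K)"
    unfolding tailstop_def K_def Let_def ..
  \<comment> \<open>Here \<open>1 \<le> k\<close> excludes the default value 0 for empty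
    \<open>K\<close>.\<close>
  then have "tailstop m \<alpha> t = k \<longleftrightarrow> k \<in> K \<and> (\<forall>i\<in>K. i \<le> k)"
    using \<open>1 \<le> k\<close> by (auto simp: Max_eq_iff)
  also have "\<dots> \<longleftrightarrow> \<not> \<alpha> * real k / real m < qstar m t k \<and>
      (\<forall>i\<in>{k+1..m}. \<alpha> * real i / real m < qstar m t i)"
  proof -
    have I: "{k+1..m} = {i \<in> {1..m}. k < i}" by auto
    have "(\<forall>i\<in>K. i \<le> k) \<longleftrightarrow> (\<forall>i\<in>{k+1..m}. \<alpha> * real i / real m < qstar m t i)"
      unfolding I K_def by (auto simp: not_le[symmetric])
    then show ?thesis using assms by (simp add: K_def not_less)
  qed
  also have "\<dots> \<longleftrightarrow> real m / (\<alpha> * real k) \<le> exp (\<Sum>i=k+1..m. t i) * exp (t k) \<and>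
      (\<forall>i\<in>{k+1..m}. \<alpha> * real i / real m < qstar m t i)"
    using threshold_less_qstar_iff[OF assms, of t] exp_sum_split_first[OF \<open>k \<le> m\<close>, of t]
    by (simp add: not_less)
  finally show ?thesis
    by (auto simp: crossing_def survival_def)
qed

section \<open>Independence of the next statistic from the scan so far\<close>

lemma survival_restrict: "survival m \<alpha> (restrict t {k+1..m}) k = survival m \<alpha> t k"
proof -
  have "(\<Sum>j=i..m. restrict t {k+1..m} j) = (\<Sum>j=i..m. t j)" if "k + 1 \<le> i" for i
    using that by (intro sum.cong) auto
  then show ?thesis by (simp add: survival_def qstar_def)
qed

lemma measurable_survival:
  "(\<lambda>t. survival m \<alpha> t k) \<in> borel_measurable (PiM {k+1..m} (\<lambda>_. borel))"
proof -
  have [measurable]: "(\<lambda>t. \<Sum>j=i..m. t j) \<in> borel_measurable (PiM {k+1..m} (\<lambda>_. borel :: real measure))"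
    if "i \<in> {k+1..m}" for i
    using that by (intro borel_measurable_sum measurable_component_singleton) auto
  have [measurable]: "(\<lambda>t. \<Sum>j=k+1..m. t j) \<in> borel_measurable (PiM {k+1..m} (\<lambda>_. borel :: real measure))"
    by (intro borel_measurable_sum measurable_component_singleton) auto
  show ?thesis
    unfolding survival_def qstar_def by measurable
qed

text \<open>The two variables are functions of the disjoint blocks \<open>{k}\<close> and
  \<open>{k+1..m}\<close>, both inside the independent null range because
  \<open>s < k\<close>.\<close>

lemma (in prob_space) indep_survival:
  assumes "indep_vars (\<lambda>_. borel) T {s+1..m}" "s < k" "k \<le> m"
  shows "indep_var borel (T k) borel (\<lambda>\<omega>. survival m \<alpha> (\<lambda>i. T i \<omega>) k)"
proof -
  have "indep_var
    borel ((\<lambda>f. f k) \<circ> (\<lambda>\<omega>. restrict (\<lambda>i. T i \<omega>) {k}))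
    borel ((\<lambda>f. survival m \<alpha> f k) \<circ> (\<lambda>\<omega>. restrict (\<lambda>i. T i \<omega>) {k+1..m}))"
    using assms(2,3)
    by (intro indep_var_compose[OF indep_var_restrict[OF assms(1)]] measurable_survival) auto
  then show ?thesis by (simp only: comp_def survival_restrict restrict_apply insertI1 if_True)
qed

section \<open>Summation over the null indices\<close>

lemma tailstop_le: "tailstop m \<alpha> t \<le> m"
proof -
  have "Max K \<le> m" if "K \<noteq> {}" "K \<subseteq> {1..m}" for K
    using that finite_subset[OF that(2)] by auto
  then show ?thesis by (auto simp: tailstop_def Let_def)
qed

text \<open>At most one indicator is nonzero, and stopping at or below \<open>s\<close> makes no
  false rejection. The false discovery rate therefore involves only crossings at null
  indices.\<close>

lemma fdp_eq_sum:
  assumes "k \<le> m"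
  shows "fdp s k = (\<Sum>l=s+1..m. (real l - real s) / real l * (if k = l then 1 else 0))"
proof -
  have "(\<Sum>l=s+1..m. (real l - real s) / real l * (if k = l then 1 else 0))
      = (\<Sum>l=s+1..m. if k = l then (real l - real s) / real l else 0)"
    by (intro sum.cong) auto
  also have "\<dots> = fdp s k"
    using assms by (auto simp: fdp_def)
  finally show ?thesis ..
qed

theorem theorem4:
  fixes M :: "'a measure" and m s :: nat and \<alpha> :: real
    and T :: "nat \<Rightarrow> 'a \<Rightarrow> real"
  assumes "prob_space M"
    and "1 \<le> m" and "s \<le> m"
    and "0 < \<alpha>" and "\<alpha> < 1"
    and "\<And>i. i \<in> {1..m} \<Longrightarrow> T i \<in> borel_measurable M"
    and "\<And>i. i \<in> {1..m} \<Longrightarrow> AE \<omega> in M. 0 \<le> T i \<omega>"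
    and "prob_space.indep_vars M (\<lambda>_. borel) T {s+1..m}"
    and "\<And>j. j \<in> {1..m - s} \<Longrightarrow>
           distributed M lborel (T (s + j)) (exponential_density (real j))"
  shows "FDR M s (\<lambda>\<omega>. tailstop m \<alpha> (\<lambda>i. T i \<omega>)) = \<alpha> * ((real m - real s) / real m) \<and>
         controls_FDR M s (\<lambda>\<omega>. tailstop m \<alpha> (\<lambda>i. T i \<omega>)) \<alpha>"
proof -
  interpret prob_space M by fact
  define Y where "Y k \<omega> = survival m \<alpha> (\<lambda>i. T i \<omega>) k" for k \<omega>
  define C where "C k \<omega> = crossing (real m / (\<alpha> * real k)) (T k \<omega>) (Y k \<omega>)" for k \<omega>
  define V where "V k = \<alpha> / real m * (real k - real s) * expectation (Y k)" for k
  have C: "C k \<omega> = (if tailstop m \<alpha> (\<lambda>i. T i \<omega>) = k then 1 else 0)"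
    if "k \<in> {s+1..m}" for k \<omega>
    using that assms(4) unfolding C_def Y_def by (intro crossing_survival) auto
  have indep: "indep_var borel (T k) borel (Y k)" if "k \<in> {s+1..m}" for k
    using that indep_survival[OF assms(8), of k \<alpha>] by (simp add: Y_def[abs_def])
  have int: "integrable M (C k)" if "k \<in> {s+1..m}" for k
  proof (rule integrable_const_bound[where B=1])
    have [measurable]: "T k \<in> borel_measurable M" "Y k \<in> borel_measurable M"
      using indep[OF that] by (auto dest: indep_var_rv1 indep_var_rv2)
    show "C k \<in> borel_measurable M"
      unfolding C_def[abs_def] crossing_def by measurable
  qed (simp add: C_def crossing_nonneg crossing_le)
  have step: "(real k - real s) / real k * expectation (C k) = V k - V (k - 1)"
    if k: "k \<in> {s+1..m}" for k
  proof -
    define b where "b = real m / (\<alpha> * real k)"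
    have "Y (k - 1) \<omega> = advance b (T k \<omega>) (Y k \<omega>)" for \<omega>
      using k assms(4) survival_step[of \<alpha> k m "\<lambda>i. T i \<omega>"] by (simp add: Y_def b_def)
    moreover have "distributed M lborel (T k) (exponential_density (real k - real s))"
    proof -
      from k have "k - s \<in> {1..m - s}" by auto
      from assms(9)[OF this] k show ?thesis by (simp add: of_nat_diff)
    qed
    \<comment> \<open>The one-step identity with rate \<open>j = k - s\<close>; its
      \<open>advance\<close> term is the state after index \<open>k\<close>, namely
      \<open>Y (k - 1)\<close>.\<close>
    ultimately have "(real k - real s - 1) * expectation (Y (k - 1)) +
        (real k - real s) * b * expectation (C k) = (real k - real s) * expectation (Y k)"
      using expectation_exponential_step[OF indep[OF k], of "real k - real s" b] k assms(4,5)
        survival_le[of \<alpha> k m]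
      by (simp add: C_def[abs_def] b_def[symmetric] Y_def survival_nonneg cong: Bochner_Integration.integral_cong)
    then have "(real k - real s) * b * expectation (C k) =
        (real k - real s) * expectation (Y k) - (real k - real s - 1) * expectation (Y (k - 1))"
      by linarith
    \<comment> \<open>The weights \<open>j\<close> and \<open>j - 1\<close> are \<open>k - s\<close>
      and \<open>(k - 1) - s\<close>, exactly those in \<open>V k\<close> and
      \<open>V (k - 1)\<close>.\<close>
    then have "\<alpha> / real m * ((real k - real s) * b * expectation (C k)) = V k - V (k - 1)"
      using k by (simp only: V_def) (simp add: of_nat_diff algebra_simps add_divide_distrib)
    moreover have "\<alpha> / real m * b = 1 / real k"
      using assms k by (simp add: b_def)
    ultimately show ?thesis
      by (metis (no_types, opaque_lifting) mult.assoc mult.commute times_divide_eq_right mult_1_right)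
  qed
  have "FDR M s (\<lambda>\<omega>. tailstop m \<alpha> (\<lambda>i. T i \<omega>))
      = expectation (\<lambda>\<omega>. \<Sum>k=s+1..m. (real k - real s) / real k * C k \<omega>)"
    unfolding FDR_def fdp_eq_sum[OF tailstop_le]
    by (intro Bochner_Integration.integral_cong sum.cong refl) (simp add: C)
  also have "\<dots> = (\<Sum>k=s+1..m. (real k - real s) / real k * expectation (C k))"
    using int by (subst Bochner_Integration.integral_sum) auto
  also have "\<dots> = (\<Sum>k=s+1..m. V k - V (k - 1))"
    by (intro sum.cong refl step)
  also have "\<dots> = V m - V s"
    using sum_telescope''[OF \<open>s \<le> m\<close>, of V] by (simp add: atLeastSucAtMost_greaterThanAtMost)
  \<comment> \<open>\<open>V s\<close> vanishes through its coefficient, whatever \<open>Y s\<close>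
    is, and \<open>Y m\<close> is constantly 1 because no index has been scanned yet.\<close>
  also have "\<dots> = \<alpha> * ((real m - real s) / real m)"
    by (simp add: V_def Y_def[abs_def] survival_top prob_space)
  finally have FDR: "FDR M s (\<lambda>\<omega>. tailstop m \<alpha> (\<lambda>i. T i \<omega>)) = \<alpha> * ((real m - real s) / real m)" .
  moreover have "\<alpha> * ((real m - real s) / real m) \<le> \<alpha>"
    using assms by (intro mult_left_le) auto
  ultimately show ?thesis by (simp add: controls_FDR_def)
qed

end
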